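(* Let $\zeta$ be a Pisot number with Pisot polynomial $P_{\zeta}$ and let $q$ be a prime with $q\nmid P_{\zeta}(0)$. Then for every element of $\mathscr{M}_{\zeta}$, the multiplicity of $q$ in its denominator in reduced form is at most $\nu_{q}(\Delta(P_{\zeta}))$. Consequently, if $\zeta$ is an algebraic unit, then the denominator in reduced form of every element of $\mathscr{M}_{\zeta}$ divides $\Delta(P_{\zeta})$.
   Context: A Pisot number is a real algebraic integer $\zeta>1$ all of whose conjugates other than $\zeta$ lie strictly inside the unit circle of $\mathbb{C}$; its Pisot polynomial $P_{\zeta}$ is its (monic, integer) minimal polynomial, of degree $k$. For real $\zeta>1$, $\mathscr{M}_{\zeta}$ denotes the set of all $\alpha\in\mathbb{R}$ with $\Vert\alpha\zeta^{n}\Vert\to0$ as $n\to\infty$, where $\Vert x\Vert$ is the distance from $x$ to the nearest integer; one has $\mathscr{M}_{\zeta}\subset\mathbb{Q}(\zeta)$. Every $a\in\mathbb{Q}(\zeta)$ can be written in reduced form $a=(r_{0}+r_{1}\zeta+\cdots+r_{k-1}\zeta^{k-1})/N$ with integers $r_{j},N$, $N\geq1$, and $\gcd(r_{0},\dots,r_{k-1},N)=1$; $N$ is the denominator of $a$ in reduced form. For a monic polynomial $P$ with complex roots $x_{1},\dots,x_{k}$, $\Delta(P)=\prod_{i<j}(x_{i}-x_{j})^{2}\in\mathbb{Z}$. For an integer $N$ and prime $p$, $\nu_{p}(N)$ is the exponent of $p$ in $N$. *)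

theory Defs
  imports "HOL-Computational_Algebra.Computational_Algebra"
begin

(* For an algebraic integer x this is the minimal polynomial of x over the rationals, which has
   integer coefficients; it is unspecified for every other x. *)
definition int_min_poly :: "real \<Rightarrow> int poly" where
  "int_min_poly x = (THE p. lead_coeff p = 1 \<and> poly (map_poly of_int p) x = 0 \<and>
     (\<forall>g :: rat poly. g \<noteq> 0 \<and> poly (map_poly of_rat g) x = 0 \<longrightarrow> degree p \<le> degree g))"

definition conjugates :: "real \<Rightarrow> complex set" where
  "conjugates x = {z. poly (map_poly of_int (int_min_poly x)) z = 0}"

definition pisot_number :: "real \<Rightarrow> bool" where
  "pisot_number \<zeta> \<longleftrightarrow> algebraic_int \<zeta> \<and> \<zeta> > 1 \<and>
     (\<forall>z \<in> conjugates \<zeta> - {complex_of_real \<zeta>}. cmod z < 1)"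

abbreviation pisot_poly :: "real \<Rightarrow> int poly" where
  "pisot_poly \<equiv> int_min_poly"

definition algebraic_unit :: "real \<Rightarrow> bool" where
  "algebraic_unit x \<longleftrightarrow> x \<noteq> 0 \<and> algebraic_int x \<and> algebraic_int (inverse x)"

definition dist_nearest_int :: "real \<Rightarrow> real" where
  "dist_nearest_int x = \<bar>x - of_int (round x)\<bar>"

definition pisot_set :: "real \<Rightarrow> real set" where
  "pisot_set \<zeta> = {\<alpha>. (\<lambda>n. dist_nearest_int (\<alpha> * \<zeta> ^ n)) \<longlonglongrightarrow> 0}"

definition is_reduced_form :: "real \<Rightarrow> real \<Rightarrow> (nat \<Rightarrow> int) \<Rightarrow> int \<Rightarrow> bool" where
  "is_reduced_form \<zeta> a r N \<longleftrightarrow>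
     (let k = degree (int_min_poly \<zeta>) in
        N \<ge> 1 \<and> Gcd (insert N (r ` {..<k})) = 1 \<and>
        a = (\<Sum>j<k. of_int (r j) * \<zeta> ^ j) / of_int N)"

(* For an algebraic integer \<zeta> the powers \<zeta>^j with j < k are linearly independent over the
   rationals, so N is determined by a. It exists exactly when a lies in the field generated
   by \<zeta>; for other a the value is unspecified. *)
definition reduced_denominator :: "real \<Rightarrow> real \<Rightarrow> int" where
  "reduced_denominator \<zeta> a = (THE N. \<exists>r. is_reduced_form \<zeta> a r N)"

(* The discriminant of a monic polynomial. The list xs enumerates the complex roots with
   multiplicity; the product does not depend on their order. *)
definition poly_discriminant :: "int poly \<Rightarrow> int" where
  "poly_discriminant P = (THE d. \<forall>xs :: complex list. mset xs = proots (map_poly of_int P) \<longrightarrow>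
     of_int d = (\<Prod>j<length xs. \<Prod>i<j. (xs ! i - xs ! j)\<^sup>2))"

end

theory Submission
  imports Defs "Jordan_Normal_Form.Char_Poly"
begin

text \<open>Let \<open>P\<close> be the Pisot polynomial and \<open>a \<in> M\<^sub>\<zeta>\<close>. The nearest integers to \<open>a \<zeta>\<^sup>n\<close>
  eventually satisfy the linear recurrence with characteristic polynomial \<open>P\<close>, which forces
  \<open>a \<zeta>\<^sup>n P'(\<zeta>) \<in> \<int>[\<zeta>]\<close> for some \<open>n\<close>. In \<open>\<int>[\<zeta>]\<close> the number \<open>P'(\<zeta>)\<close> divides its norm
  \<open>\<plusminus>\<Delta>(P)\<close>, and \<open>\<zeta>\<close> divides \<open>P(0)\<close>, so \<open>\<Delta>(P) P(0)\<^sup>n a \<in> \<int>[\<zeta>]\<close>. Hence the reduced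
  denominator of \<open>a\<close> divides \<open>\<Delta>(P) P(0)\<^sup>n\<close>. If \<open>\<zeta>\<close> is a unit, then \<open>P(0) = \<plusminus>1\<close>.\<close>

hide_const (open) module.smult

subsection \<open>Minimal polynomials of algebraic integers\<close>

lemma degree_pos_of_root:
  fixes p :: "int poly" and x :: "'a :: {comm_ring_1, ring_char_0}"
  assumes "p \<noteq> 0" "poly (of_int_poly p) x = 0"
  shows "degree p > 0"
proof (rule ccontr)
  assume "\<not> degree p > 0"
  then obtain c where "p = [:c:]" by (auto elim: degree_eq_zeroE)
  with assms show False by simp
qed

text \<open>Pseudo-division scales \<open>f\<close> by a power of the leading coefficient, which is
  1 here. Positive degree makes the bound strict for the zero remainder too.\<close>

lemma monic_division:
  fixes f p :: "'a :: idom poly"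
  assumes "lead_coeff p = 1" "degree p > 0"
  obtains q r where "f = p * q + r" "degree r < degree p"
proof -
  obtain q r where qr: "pseudo_divmod f p = (q, r)" by fastforce
  have "p \<noteq> 0" using assms by auto
  from pseudo_divmod[OF this qr] assms show ?thesis
    by (intro that[of q r]) auto
qed

text \<open>Pseudo-division by a polynomial of least degree replaces the passage to \<open>\<rat>[x]\<close>.\<close>

lemma prime_elem_degree_le_int:
  fixes p :: "int poly" and x :: "'a :: field_char_0"
  assumes p: "prime_elem p" "poly (of_int_poly p) x = 0"
    and h: "h \<noteq> 0" "poly (of_int_poly h) x = 0"
  shows "degree p \<le> degree h"
proof -
  define Q where "Q = (\<lambda>n. \<exists>g :: int poly. g \<noteq> 0 \<and> poly (of_int_poly g) x = 0 \<and> degree g = n)"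
  have "Q (degree h)" using h Q_def by blast
  then have "Q (LEAST n. Q n)" and least: "(LEAST n. Q n) \<le> degree h"
    by (auto intro: LeastI Least_le)
  then obtain g :: "int poly" where g: "g \<noteq> 0" "poly (of_int_poly g) x = 0" "degree g = (LEAST n. Q n)"
    unfolding Q_def by blast
  have min: "degree g \<le> degree f" if "f \<noteq> 0" "poly (of_int_poly f) x = 0" for f :: "int poly"
    unfolding g(3) by (rule Least_le) (use that Q_def in blast)
  have deg: "degree g > 0" using g(1,2) by (rule degree_pos_of_root)
  obtain q r where qr: "pseudo_divmod p g = (q, r)" by fastforce
  define c where "c = lead_coeff g ^ (Suc (degree p) - degree g)"
  have c: "c \<noteq> 0" unfolding c_def using g(1) by (intro power_not_zero) simp
  from pseudo_divmod[OF g(1) qr]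
  have eq: "smult c p = g * q + r" and r: "r = 0 \<or> degree r < degree g" by (auto simp: c_def)
  have "of_int_poly (smult c p) = (of_int_poly (g * q + r) :: 'a poly)" using eq by simp
  then have "poly (of_int_poly r) x = 0"
    using p(2) g(2) by (simp add: hom_distribs) (metis add_0 mult_zero_left mult_zero_right poly_add poly_mult poly_smult)
  \<comment> \<open>\<open>r\<close> vanishes at \<open>x\<close> in smaller degree than
    \<open>g\<close>, so the minimality of \<open>g\<close> leaves only zero.\<close>
  with min[of r] r have "r = 0" by fastforce
  with eq have eq: "smult c p = g * q" by simp
  then have "p dvd g * q" by (metis dvd_smult dvd_refl)
  then have "p dvd g \<or> p dvd q" using p(1) by (simp add: prime_elem_dvd_mult_iff)
  then have "p dvd g"
  proof
    \<comment> \<open>Cancelling \<open>p\<close> would make \<open>g\<close> a divisor of the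
      nonzero constant \<open>c\<close>, against its positive degree.\<close>
    assume "p dvd q"
    then obtain t where "q = p * t" by blast
    with eq have "p * [:c:] = p * (g * t)" by (simp add: algebra_simps)
    then have "[:c:] = g * t" using p(1) by (metis mult_left_cancel prime_elem_not_zeroI)
    with c have "g dvd [:c:]" "[:c:] \<noteq> 0" by auto
    then have "degree g = 0" by (metis dvd_imp_degree_le degree_pCons_0 le_zero_eq)
    with deg show ?thesis by simp
  qed
  then have "degree p \<le> degree g" using g(1) by (rule dvd_imp_degree_le)
  with g(3) least show ?thesis by simp
qed

lemma clear_denominators:
  fixes g :: "rat poly"
  obtains d :: int and h :: "int poly" where "d \<noteq> 0" "smult (of_int d) g = of_int_poly h"
proof -
  have "\<exists>d h. d \<noteq> 0 \<and> smult (of_int d) g = of_int_poly h"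
  proof (induction g)
    case 0
    show ?case by (rule exI[of _ 1], rule exI[of _ 0]) simp
  next
    case (pCons a g)
    then obtain d h where dh: "d \<noteq> 0" "smult (of_int d) g = of_int_poly h" by blast
    obtain u v where uv: "quotient_of a = (u, v)" by fastforce
    then have v: "v > 0" and a: "a = of_int u / of_int v"
      by (auto intro: quotient_of_denom_pos quotient_of_div)
    have "smult (of_int (d * v)) (pCons a g) = of_int_poly (pCons (u * d) (smult v h))"
      using v by (simp add: a hom_distribs mult.commute flip: dh(2))
    moreover have "d * v \<noteq> 0" using dh v by simp
    ultimately show ?case by blast
  qed
  with that show ?thesis by blast
qed

text \<open>Clearing denominators changes neither the degree nor the roots. This yields the
  minimality over the rationals that \<open>int_min_poly\<close> demands.\<close>

lemma prime_elem_degree_le_rat: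
  fixes p :: "int poly" and x :: real
  assumes p: "prime_elem p" "poly (of_int_poly p) x = 0"
    and g: "g \<noteq> 0" "poly (map_poly of_rat g) x = 0"
  shows "degree p \<le> degree g"
proof -
  obtain d h where dh: "d \<noteq> 0" "smult (of_int d) g = of_int_poly h"
    by (rule clear_denominators)
  have "map_poly of_rat (smult (of_int d) g) = (map_poly of_rat (of_int_poly h) :: real poly)"
    by (simp only: dh)
  then have "smult (of_int d) (map_poly of_rat g) = (of_int_poly h :: real poly)"
    by (simp add: hom_distribs map_poly_map_poly o_def)
  then have "poly (of_int_poly h) x = 0" using g(2) by (metis mult_zero_right poly_smult)
  moreover have "degree (of_int_poly h :: rat poly) = degree g"
    using dh by (metis degree_smult_eq of_int_eq_0_iff)
  then have "degree h = degree g" by simp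
  moreover have "h \<noteq> 0" using dh g by auto
  ultimately show ?thesis using prime_elem_degree_le_int[OF p, of h] by simp
qed

text \<open>Factor a monic integer polynomial vanishing at \<open>x\<close> into primes of Z[X]:
  \<open>x\<close> is a root of some factor, whose leading coefficient divides 1 and is normalised
  by its sign.\<close>

lemma ex_monic_prime_elem:
  fixes x :: real
  assumes "algebraic_int x"
  obtains p :: "int poly" where "lead_coeff p = 1" "prime_elem p" "poly (of_int_poly p) x = 0"
proof -
  from assms obtain f :: "int poly" where f: "poly (of_int_poly f) x = 0" "lead_coeff f = 1"
    by (auto simp: algebraic_int_altdef_ipoly)
  then have f0: "f \<noteq> 0" by auto
  have "\<exists>p. prime_elem p \<and> p dvd f \<and> poly (of_int_poly p) x = 0"
    using f0 f(1)
  proof (induction f rule: prime_divisors_induct)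
    case zero
    then show ?case by simp
  next
    case (unit f)
    then have "degree f = 0" by (auto simp: is_unit_poly_iff)
    then obtain c where "f = [:c:]" by (auto elim: degree_eq_zeroE)
    with unit show ?case by simp
  next
    case (factor p f)
    show ?case
    proof (cases "poly (of_int_poly p) x = 0")
      case True
      with factor show ?thesis by (intro exI[of _ p]) auto
    next
      case False
      with factor show ?thesis by (auto simp: hom_distribs)
    qed
  qed
  then obtain p where p: "prime_elem p" "p dvd f" "poly (of_int_poly p) x = 0" by blast
  from p(2) f(2) have unit: "lead_coeff p dvd 1" by (metis dvdE dvd_triv_left lead_coeff_mult)
  define q where "q = smult (lead_coeff p) p"
  from unit have "\<bar>lead_coeff p\<bar> = 1" by simp
  then have l: "lead_coeff p * lead_coeff p = 1" by (simp add: abs_if split: if_splits)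
  have "normalize q = normalize p" 
    using unit by (auto simp: q_def normalize_smult is_unit_normalize)
  then have "prime_elem q" using p(1) by (metis prime_elem_normalize_iff)
  with p l show ?thesis
    by (intro that[of q]) (auto simp: q_def hom_distribs)
qed

lemma int_min_poly_props:
  assumes "algebraic_int x"
  shows "lead_coeff (int_min_poly x) = 1" "prime_elem (int_min_poly x)"
    "poly (of_int_poly (int_min_poly x)) x = 0"
proof -
  obtain p :: "int poly" where p: "lead_coeff p = 1" "prime_elem p" "poly (of_int_poly p) x = 0"
    using assms by (rule ex_monic_prime_elem)
  have "int_min_poly x = p"
    unfolding int_min_poly_def
  proof (rule the_equality)
    show "lead_coeff p = 1 \<and> poly (of_int_poly p) x = 0 \<and>
      (\<forall>g :: rat poly. g \<noteq> 0 \<and> poly (map_poly of_rat g) x = 0 \<longrightarrow> degree p \<le> degree g)"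
      using p prime_elem_degree_le_rat by blast
  next
    fix q :: "int poly"
    assume q: "lead_coeff q = 1 \<and> poly (of_int_poly q) x = 0 \<and>
      (\<forall>g :: rat poly. g \<noteq> 0 \<and> poly (map_poly of_rat g) x = 0 \<longrightarrow> degree q \<le> degree g)"
    have "p \<noteq> 0" "q \<noteq> 0" using p q by auto
    have "poly (map_poly of_rat (of_int_poly p :: rat poly)) x = 0"
      using p by (simp add: map_poly_map_poly o_def)
    moreover have "(of_int_poly p :: rat poly) \<noteq> 0" using \<open>p \<noteq> 0\<close> by simp
    ultimately have "degree q \<le> degree (of_int_poly p :: rat poly)" using q by blast
    moreover have "degree p \<le> degree q"
      using prime_elem_degree_le_int[OF p(2,3) \<open>q \<noteq> 0\<close>] q by simp
    ultimately have deg: "degree q = degree p" by simp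
    have "degree p > 0" using \<open>p \<noteq> 0\<close> p(3) by (rule degree_pos_of_root)
    show "q = p"
    proof (rule ccontr)
      \<comment> \<open>The leading terms of two monic polynomials of equal degree cancel, so
        \<open>q - p\<close> would vanish at \<open>x\<close> in too small a degree.\<close>
      assume "q \<noteq> p"
      then have "degree p \<le> degree (q - p)"
        using p q by (intro prime_elem_degree_le_int[OF p(2,3)]) (auto simp: hom_distribs)
      moreover have "degree (q - p) < degree p"
        using deg p q \<open>degree p > 0\<close>
        by (intro degree_lessI) (auto simp: coeff_eq_0 le_eq_less_or_eq)
      ultimately show False by simp
    qed
  qed
  with p show "lead_coeff (int_min_poly x) = 1" "prime_elem (int_min_poly x)"
    "poly (of_int_poly (int_min_poly x)) x = 0" by simp_all
qed

subsection \<open>The discriminant as a norm\<close>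

lemma poly_eq_sum_lessThan:
  fixes p :: "'a :: comm_semiring_1 poly"
  assumes "degree p < n"
  shows "poly p x = (\<Sum>i<n. coeff p i * x ^ i)"
  unfolding poly_altdef
  by (rule sum.mono_neutral_left) (use assms in \<open>auto simp: coeff_eq_0\<close>)

text \<open>A nonzero kernel vector of the transpose would be the coefficient vector of a nonzero
  polynomial of degree below \<open>n\<close> with \<open>n\<close> distinct roots.\<close>

lemma det_vandermonde_nonzero:
  fixes x :: "nat \<Rightarrow> 'a :: field"
  assumes "inj_on x {..<n}"
  shows "det (mat n n (\<lambda>(j, i). x i ^ j)) \<noteq> 0"
proof
  let ?W = "mat n n (\<lambda>(j, i). x i ^ j)"
  assume "det ?W = 0"
  then have "det (transpose_mat ?W) = 0" by (subst det_transpose[of _ n]) auto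
  then obtain v where v: "v \<in> carrier_vec n" "v \<noteq> 0\<^sub>v n" "transpose_mat ?W *\<^sub>v v = 0\<^sub>v n"
    by (subst (asm) det_0_iff_vec_prod_zero_field[of _ n]) auto
  define p where "p = (\<Sum>j<n. monom (v $ j) j)"
  have coeff: "coeff p j = (if j < n then v $ j else 0)" for j
    by (simp add: p_def coeff_sum)
  have "p \<noteq> 0"
  proof
    assume "p = 0"
    then have "v $ j = 0" if "j < n" for j using coeff[of j] that by simp
    with v(1,2) show False by (auto intro: eq_vecI)
  qed
  then have deg: "degree p < n"
    using coeff leading_coeff_neq_0 by (metis not_le not_less)
  have "poly p (x i) = 0" if "i < n" for i
  proof -
    have "0 = (transpose_mat ?W *\<^sub>v v) $ i" using v that by simp
    also have "\<dots> = (\<Sum>j<n. x i ^ j * v $ j)"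
      using v(1) that by (simp add: scalar_prod_def atLeast0LessThan)
    finally show ?thesis by (simp add: p_def poly_sum poly_monom mult.commute)
  qed
  then have "x ` {..<n} \<subseteq> {y. poly p y = 0}" by auto
  then have "card (x ` {..<n}) \<le> card {y. poly p y = 0}"
    using \<open>p \<noteq> 0\<close> by (intro card_mono poly_roots_finite)
  also have "\<dots> \<le> degree p" using \<open>p \<noteq> 0\<close> by (rule card_poly_roots_bound)
  finally show False using deg assms by (simp add: card_image)
qed

text \<open>The number \<open>D\<close> is the determinant of multiplication by \<open>f\<close> on \<open>\<int>[x]/(p)\<close>: the
  adjugate of the multiplication matrix puts it into the ideal \<open>(f, p)\<close>, and the Vandermonde
  matrix of the roots of \<open>p\<close> diagonalises the matrix.\<close>

lemma norm_modulo_monic: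
  fixes p f :: "int poly"
  assumes monic: "lead_coeff p = 1" and deg: "degree p > 0"
  obtains D V Q where "V * f = [:D:] + p * Q"
    "\<forall>x :: nat \<Rightarrow> complex. inj_on x {..<degree p} \<and>
       (\<forall>i<degree p. poly (of_int_poly p) (x i) = 0) \<longrightarrow>
       of_int D = (\<Prod>i<degree p. poly (of_int_poly f) (x i))"
proof -
  define k where "k = degree p"
  have "\<exists>q r. monom 1 i * f = p * q + r \<and> degree r < k" for i
    using monic_division[OF monic deg, of "monom 1 i * f"] unfolding k_def by metis
  then obtain q r where qr: "\<And>i. monom 1 i * f = p * q i + r i" "\<And>i. degree (r i) < k"
    by metis
  define M where "M = mat k k (\<lambda>(i, j). coeff (r i) j)"
  have M: "M \<in> carrier_mat k k" by (simp add: M_def)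
  define B where "B = adj_mat M"
  have B: "B \<in> carrier_mat k k" "B * M = det M \<cdot>\<^sub>m 1\<^sub>m k"
    using adj_mat[OF M] by (simp_all add: B_def)
  \<comment> \<open>Weighting the rows of \<open>M\<close> by row 0 of the adjugate leaves
    \<open>(det M, 0, ..., 0)\<close>, the constant polynomial \<open>det M\<close>.\<close>
  define V where "V = (\<Sum>i<k. monom (B $$ (0, i)) i)"
  define Q where "Q = (\<Sum>i<k. smult (B $$ (0, i)) (q i))"
  have rest: "(\<Sum>i<k. smult (B $$ (0, i)) (r i)) = [:det M:]"
  proof (rule poly_eqI)
    fix j
    show "coeff (\<Sum>i<k. smult (B $$ (0, i)) (r i)) j = coeff [:det M:] j"
    proof (cases "j < k")
      case True
      then have "coeff (\<Sum>i<k. smult (B $$ (0, i)) (r i)) j = (B * M) $$ (0, j)"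
        using B(1) by (simp add: coeff_sum scalar_prod_def M_def atLeast0LessThan)
      also have "\<dots> = coeff [:det M:] j"
        unfolding B(2) using True by (auto simp: coeff_pCons split: nat.split)
      finally show ?thesis .
    next
      case False
      then have "coeff (r i) j = 0" for i using qr(2)[of i] by (intro coeff_eq_0) simp
      with False deg show ?thesis by (auto simp: coeff_sum coeff_pCons k_def split: nat.split)
    qed
  qed
  have "V * f = (\<Sum>i<k. smult (B $$ (0, i)) (monom 1 i * f))"
    unfolding V_def sum_distrib_right
    by (rule sum.cong) (simp_all add: smult_monom flip: mult_smult_left)
  also have "\<dots> = (\<Sum>i<k. p * smult (B $$ (0, i)) (q i)) + (\<Sum>i<k. smult (B $$ (0, i)) (r i))"
    by (simp add: qr(1) smult_add_right sum.distrib)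
  also have "\<dots> = [:det M:] + p * Q" by (simp add: rest Q_def sum_distrib_left)
  finally have 1: "V * f = [:det M:] + p * Q" .
  have 2: "of_int (det M) = (\<Prod>i<k. poly (of_int_poly f) (x i))"
    if inj: "inj_on x {..<k}" and root: "\<And>i. i < k \<Longrightarrow> poly (of_int_poly p) (x i) = 0"
    for x :: "nat \<Rightarrow> complex"
  proof -
    let ?f = "\<lambda>i. poly (of_int_poly f) (x i)"
    define W where "W = mat k k (\<lambda>(j, i). x i ^ j)"
    define E where "E = mat k k (\<lambda>(i, j). if i = j then ?f i else 0)"
    define M' where "M' = map_mat (of_int :: int \<Rightarrow> complex) M"
    have carr: "W \<in> carrier_mat k k" "E \<in> carrier_mat k k" "M' \<in> carrier_mat k k"
      by (auto simp: W_def E_def M'_def M_def)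
    \<comment> \<open>Reduction modulo \<open>p\<close> does not change values at a root of
      \<open>p\<close>, so column \<open>i\<close> of \<open>W\<close> is an eigenvector with
      eigenvalue \<open>?f i\<close>.\<close>
    have "M' * W = W * E"
    proof (rule eq_matI)
      fix j i assume "j < dim_row (W * E)" "i < dim_col (W * E)"
      then have ij: "j < k" "i < k" using carr by auto
      have "(M' * W) $$ (j, i) = (\<Sum>l<k. of_int (coeff (r j) l) * x i ^ l)"
        using ij by (simp add: M'_def M_def W_def scalar_prod_def atLeast0LessThan)
      also have "\<dots> = poly (of_int_poly (r j)) (x i)"
        using qr(2)[of j] by (subst poly_eq_sum_lessThan[of _ k]) auto
      also have "\<dots> = poly (of_int_poly (monom 1 j * f)) (x i)"
        by (simp add: qr(1) hom_distribs root ij)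
      also have "\<dots> = x i ^ j * ?f i" by (simp add: hom_distribs poly_monom)
      also have "\<dots> = (\<Sum>l<k. if l = i then x l ^ j * ?f l else 0)" using ij by simp
      also have "\<dots> = (\<Sum>l<k. x l ^ j * (if l = i then ?f l else 0))"
        by (rule sum.cong) auto
      also have "\<dots> = (W * E) $$ (j, i)"
        using ij by (simp add: W_def E_def scalar_prod_def atLeast0LessThan)
      finally show "(M' * W) $$ (j, i) = (W * E) $$ (j, i)" .
    qed (use carr in auto)
    then have "det M' * det W = det W * det E"
      using carr by (metis det_mult)
    moreover have "det W \<noteq> 0" unfolding W_def using inj by (rule det_vandermonde_nonzero)
    ultimately have "det M' = det E" by simp
    moreover have "det E = (\<Prod>i<k. ?f i)"
      by (subst det_upper_triangular[of _ k])
        (auto simp: E_def diag_mat_def upper_triangular_def prod.list_conv_set_nth atLeast0LessThan)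
    ultimately show ?thesis by (simp add: M'_def)
  qed
  show ?thesis by (rule that[OF 1, folded k_def]) (use 2 in simp)
qed

section \<open>Differences of roots and the discriminant\<close>

lemma poly_pderiv_prod_linear:
  fixes x :: "'b \<Rightarrow> 'a :: idom"
  assumes "finite A" "j \<in> A"
  shows "poly (pderiv (\<Prod>i\<in>A. [:- x i, 1:])) (x j) = (\<Prod>i\<in>A - {j}. x j - x i)"
proof -
  have "poly (pderiv (\<Prod>i\<in>A. [:- x i, 1:])) (x j) = (\<Sum>a\<in>A. \<Prod>i\<in>A - {a}. x j - x i)"
    by (simp add: pderiv_prod poly_sum poly_prod pderiv_pCons)
  \<comment> \<open>A term that omits a factor other than the one for \<open>j\<close> still
    contains \<open>x j - x j = 0\<close>.\<close>
  also have "\<dots> = (\<Sum>a\<in>{j}. \<Prod>i\<in>A - {a}. x j - x i)"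
    by (rule sum.mono_neutral_right) (use assms in \<open>auto intro!: prod_zero\<close>)
  finally show ?thesis by simp
qed

text \<open>Each square is \<open>-1\<close> times the product of the two oppositely ordered
  differences, and index \<open>j\<close> contributes \<open>j\<close> such signs. For the roots of
  a monic polynomial the inner products on the right are values of its derivative.\<close>

lemma prod_root_differences:
  fixes x :: "nat \<Rightarrow> 'a :: comm_ring_1"
  shows "(\<Prod>j<n. \<Prod>i<j. (x i - x j)\<^sup>2) =
    (\<Prod>j<n. (- 1) ^ j) * (\<Prod>j<n. \<Prod>i\<in>{..<n} - {j}. x j - x i)"
proof (induction n)
  case (Suc n)
  have "(\<Prod>i\<in>{..<Suc n} - {j}. x j - x i) = (\<Prod>i\<in>{..<n} - {j}. x j - x i) * (x j - x n)"
    if "j < n" for j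
  proof -
    have "{..<Suc n} - {j} = insert n ({..<n} - {j})" using that by auto
    then show ?thesis by (simp add: mult.commute)
  qed
  moreover have "{..<Suc n} - {n} = {..<n}" by auto
  ultimately have "(\<Prod>j<Suc n. \<Prod>i\<in>{..<Suc n} - {j}. x j - x i) =
      (\<Prod>j<n. \<Prod>i\<in>{..<n} - {j}. x j - x i) * ((\<Prod>j<n. x j - x n) * (\<Prod>j<n. x n - x j))"
    by (simp add: prod.distrib mult.assoc)
  moreover have "(\<Prod>i<n. (x i - x n)\<^sup>2) = (\<Prod>i<n. (- 1) * ((x i - x n) * (x n - x i)))"
    by (rule prod.cong) (auto simp: power2_eq_square algebra_simps)
  then have "(\<Prod>i<n. (x i - x n)\<^sup>2) = (- 1) ^ n * ((\<Prod>j<n. x j - x n) * (\<Prod>j<n. x n - x j))"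
    by (simp only: prod.distrib prod_constant card_lessThan)
  ultimately show ?case using Suc by (simp add: algebra_simps)
qed simp

lemma proots_factorization:
  fixes p :: "complex poly"
  assumes "lead_coeff p = 1" "mset xs = proots p"
  shows "length xs = degree p" "p = (\<Prod>i<length xs. [:- xs ! i, 1:])"
proof -
  show "length xs = degree p" using assms(2) by (metis size_mset size_proots_complex)
  have "p = (\<Prod>x\<in>#mset xs. [:- x, 1:])"
    using complex_poly_decompose_multiset[of p] assms by simp
  also have "\<dots> = prod_list (map (\<lambda>x. [:- x, 1:]) xs)"
    by (metis mset_map prod_mset_prod_list)
  also have "\<dots> = (\<Prod>i<length xs. [:- xs ! i, 1:])"
    by (simp add: prod.list_conv_set_nth atLeast0LessThan)
  finally show "p = (\<Prod>i<length xs. [:- xs ! i, 1:])" .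
qed

text \<open>The norm of the derivative is the product of its values at the roots, which is the
  discriminant up to sign. It is nonzero because a prime \<open>p\<close> of positive degree has
  only simple roots.\<close>

lemma poly_discriminant_in_ideal:
  fixes p :: "int poly"
  assumes monic: "lead_coeff p = 1" and prime: "prime_elem p" and deg: "degree p > 0"
  obtains V Q where "V * pderiv p = [:poly_discriminant p:] + p * Q" "poly_discriminant p \<noteq> 0"
proof -
  define k where "k = degree p"
  define s :: int where "s = (\<Prod>j<k. (- 1) ^ j)"
  have s: "s \<noteq> 0" by (simp add: s_def)
  obtain D V Q where VQ: "V * pderiv p = [:D:] + p * Q"
    and D: "\<forall>x :: nat \<Rightarrow> complex. inj_on x {..<k} \<and>
       (\<forall>i<k. poly (of_int_poly p) (x i) = 0) \<longrightarrow>
       of_int D = (\<Prod>i<k. poly (of_int_poly (pderiv p)) (x i))"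
    using norm_modulo_monic[OF monic deg, of "pderiv p", folded k_def] .
  \<comment> \<open>A common root would force the nonzero \<open>pderiv p\<close> to have degree at
    least that of \<open>p\<close>.\<close>
  have simple: "poly (of_int_poly (pderiv p)) x \<noteq> 0" if "poly (of_int_poly p) x = 0" for x :: complex
  proof
    assume "poly (of_int_poly (pderiv p)) x = 0"
    moreover have "pderiv p \<noteq> 0" using deg by (simp add: pderiv_eq_0_iff)
    ultimately have "degree p \<le> degree (pderiv p)"
      using prime_elem_degree_le_int[OF prime that] by blast
    with deg show False by (simp add: degree_pderiv)
  qed
  have disc: "of_int (s * D) = (\<Prod>j<length xs. \<Prod>i<j. (xs ! i - xs ! j)\<^sup>2)" "D \<noteq> 0"
    if xs: "mset xs = proots (of_int_poly p :: complex poly)" for xs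
  proof -
    have fac: "length xs = k" "of_int_poly p = (\<Prod>i<k. [:- xs ! i, 1:])"
      using proots_factorization[OF _ xs] monic by (simp_all add: k_def)
    have root: "poly (of_int_poly p) (xs ! i) = 0" if "i < k" for i
      using that by (auto simp: fac(2) poly_prod intro!: prod_zero)
    have pd: "poly (of_int_poly (pderiv p)) (xs ! j) = (\<Prod>i\<in>{..<k} - {j}. xs ! j - xs ! i)"
      if "j < k" for j
    proof -
      have "of_int_poly (pderiv p) = pderiv (of_int_poly p :: complex poly)"
        by (simp add: of_int_hom.map_poly_pderiv)
      then show ?thesis using that by (simp add: fac(2) poly_pderiv_prod_linear)
    qed
    have "inj_on ((!) xs) {..<k}"
    proof (rule inj_onI, rule ccontr)
      fix i j assume "i \<in> {..<k}" "j \<in> {..<k}" "xs ! i = xs ! j" "i \<noteq> j"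
      then have "(\<Prod>i\<in>{..<k} - {j}. xs ! j - xs ! i) = 0"
        by (intro prod_zero bexI[of _ i]) auto
      with pd[of j] simple[OF root[of j]] \<open>j \<in> {..<k}\<close> show False by simp
    qed
    with D root have eq: "of_int D = (\<Prod>i<k. poly (of_int_poly (pderiv p)) (xs ! i))" by blast
    then have "(of_int D :: complex) \<noteq> 0" using simple[OF root] by simp
    then show "D \<noteq> 0" by simp
    show "of_int (s * D) = (\<Prod>j<length xs. \<Prod>i<j. (xs ! i - xs ! j)\<^sup>2)"
      unfolding prod_root_differences fac(1) using eq by (simp add: pd s_def)
  qed
  \<comment> \<open>Without an enumeration of the roots the condition in
    \<open>poly_discriminant\<close> would hold vacuously and determine no integer.\<close>
  obtain xs where xs: "mset xs = proots (of_int_poly p :: complex poly)" by (metis ex_mset)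
  have "poly_discriminant p = s * D"
    unfolding poly_discriminant_def
  proof (rule the_equality)
    fix d assume "\<forall>xs. mset xs = proots (of_int_poly p) \<longrightarrow>
      (of_int d :: complex) = (\<Prod>j<length xs. \<Prod>i<j. (xs ! i - xs ! j)\<^sup>2)"
    with xs have "(of_int d :: complex) = of_int (s * D)" unfolding disc(1)[OF xs] by simp
    then show "d = s * D" by (simp only: of_int_eq_iff)
  qed (use disc(1) in simp)
  moreover have "smult s V * pderiv p = [:s * D:] + p * smult s Q"
    by (simp add: VQ smult_add_right)
  ultimately show ?thesis
    using s disc(2)[OF xs] by (intro that[of "smult s V" "smult s Q"]) simp_all
qed

subsection \<open>Nearest integers to a geometric sequence\<close>

text \<open>By Horner's scheme, coefficient \<open>i\<close> of the quotient is the value at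
  \<open>x\<close> of \<open>p\<close> with its lowest \<open>i + 1\<close> coefficients removed and
  the rest shifted down.\<close>

lemma coeff_synthetic_div_int_poly:
  fixes x :: "'a :: comm_ring_1"
  obtains h where "coeff (synthetic_div (of_int_poly p) x) i = poly (of_int_poly h) x"
proof -
  have "\<exists>h. coeff (synthetic_div (of_int_poly p) x) i = poly (of_int_poly h) x"
  proof (induction p arbitrary: i)
    case 0
    show ?case by (rule exI[of _ 0]) simp
  next
    case (pCons a p)
    show ?case
    proof (cases i)
      case 0
      then show ?thesis by (intro exI[of _ p]) (simp add: hom_distribs)
    next
      case (Suc j)
      with pCons.IH[of j] show ?thesis by (simp add: hom_distribs)
    qed
  qed
  with that show ?thesis by blast
qed

lemma tendsto_int_zero_eventually_zero:
  fixes t :: "nat \<Rightarrow> int"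
  assumes "(\<lambda>n. of_int (t n) :: real) \<longlonglongrightarrow> 0"
  obtains n0 where "\<And>n. n \<ge> n0 \<Longrightarrow> t n = 0"
proof -
  from assms have "eventually (\<lambda>n. dist (of_int (t n) :: real) 0 < 1) sequentially"
    by (rule tendstoD) simp
  then obtain n0 where "\<And>n. n \<ge> n0 \<Longrightarrow> \<bar>of_int (t n) :: real\<bar> < 1"
    by (auto simp: eventually_sequentially)
  then have "t n = 0" if "n \<ge> n0" for n using that by fastforce
  then show ?thesis by (rule that)
qed

text \<open>With \<open>b n\<close> the nearest integer to \<open>a x\<^sup>n\<close>, the integers \<open>t n\<close> obtained by applying \<open>p\<close> to
  the shift of \<open>b\<close> tend to \<open>0\<close>, hence vanish eventually. The cofactor \<open>q = p / (X - x)\<close>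
  therefore turns \<open>b\<close> into a sequence \<open>L\<close> in \<open>\<int>[x]\<close> that is eventually geometric with ratio
  \<open>x\<close>. As \<open>L n\<close> stays close to \<open>a x\<^sup>n q(x)\<close> while \<open>x > 1\<close>, the two agree, and \<open>q(x) = p'(x)\<close>.\<close>

lemma nearest_int_tendsto_zero_imp:
  fixes p :: "int poly" and x a :: real
  assumes root: "poly (of_int_poly p) x = 0" and x: "x > 1"
    and lim: "(\<lambda>n. dist_nearest_int (a * x ^ n)) \<longlonglongrightarrow> 0"
  obtains n h where "a * x ^ n * poly (of_int_poly (pderiv p)) x = poly (of_int_poly h) x"
proof -
  define k where "k = degree p"
  define b where "b = (\<lambda>n. round (a * x ^ n))"
  define e where "e = (\<lambda>n. a * x ^ n - of_int (b n))"
  have b: "of_int (b n) = a * x ^ n - e n" for n by (simp add: e_def)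
  have e: "e \<longlonglongrightarrow> 0"
    using lim by (simp add: dist_nearest_int_def e_def b_def tendsto_rabs_zero_iff)
  have e_shift: "(\<lambda>n. \<Sum>i\<in>A. c i * e (n + m + i)) \<longlonglongrightarrow> 0" for A :: "nat set" and c m
  proof -
    have "(\<lambda>n. e (n + (m + i))) \<longlonglongrightarrow> 0" for i by (rule LIMSEQ_ignore_initial_segment[OF e])
    then show ?thesis by (intro tendsto_null_sum tendsto_mult_right_zero) (simp add: add.assoc)
  qed
  define t where "t = (\<lambda>n. \<Sum>i\<le>k. coeff p i * b (n + i))"
  \<comment> \<open>The main terms add up to a multiple of the value of \<open>p\<close> at
    \<open>x\<close>, which is 0, so only rounding errors remain.\<close>
  have "of_int (t n) = - (\<Sum>i\<le>k. of_int (coeff p i) * e (n + i))" for n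
  proof -
    have "(\<Sum>i\<le>k. of_int (coeff p i) * (a * x ^ (n + i))) = a * x ^ n * poly (of_int_poly p) x"
      by (simp add: poly_altdef k_def sum_distrib_left power_add mult_ac)
    with root show ?thesis by (simp add: t_def b right_diff_distrib sum_subtractf)
  qed
  moreover have "(\<lambda>n. - (\<Sum>i\<le>k. of_int (coeff p i) * e (n + i))) \<longlonglongrightarrow> 0"
    using tendsto_minus[OF e_shift[of "\<lambda>i. of_int (coeff p i)" 0 "{..k}"]] by simp
  ultimately have "(\<lambda>n. of_int (t n) :: real) \<longlonglongrightarrow> 0" by simp
  then obtain n0 where t0: "\<And>n. n \<ge> n0 \<Longrightarrow> t n = 0"
    by (rule tendsto_int_zero_eventually_zero) blast
  define q where "q = synthetic_div (of_int_poly p) x"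
  have pq: "[:- x, 1:] * q = of_int_poly p"
    using synthetic_div_correct'[of x "of_int_poly p"] root by (simp add: q_def)
  define L where "L = (\<lambda>n. \<Sum>i<k. coeff q i * of_int (b (n + i)))"
  \<comment> \<open>\<open>q\<close> has degree \<open>k - 1\<close>, so the sum in
    \<open>L n\<close> may run up to \<open>k\<close> as well.\<close>
  have coeff_k: "coeff q k = 0" if "k > 0"
    using that by (intro coeff_eq_0) (simp add: q_def degree_synthetic_div k_def)
  have L_Suc: "L (Suc n) = x * L n" if "n \<ge> n0" for n
  proof (cases k)
    case 0
    then show ?thesis by (simp add: L_def)
  next
    case (Suc m)
    \<comment> \<open>Comparing coefficients in \<open>p = (X - x) * q\<close> gives
      \<open>t n = L (Suc n) - x * L n\<close>.\<close>
    have c: "of_int (coeff p i) = (case i of 0 \<Rightarrow> 0 | Suc j \<Rightarrow> coeff q j) - x * coeff q i" for i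
      using arg_cong[OF pq, of "\<lambda>f. coeff f i"] by (simp add: coeff_pCons)
    have "0 = (of_int (t n) :: real)" using t0 that by simp
    also have "\<dots> = (\<Sum>i\<le>k. (case i of 0 \<Rightarrow> 0 | Suc j \<Rightarrow> coeff q j) * of_int (b (n + i)))
        - x * (\<Sum>i\<le>k. coeff q i * of_int (b (n + i)))"
      by (simp add: t_def c left_diff_distrib sum_subtractf sum_distrib_left mult.assoc)
    also have "(\<Sum>i\<le>k. coeff q i * of_int (b (n + i))) = L n"
      using coeff_k Suc by (simp add: L_def lessThan_Suc_atMost)
    also have "(\<Sum>i\<le>k. (case i of 0 \<Rightarrow> 0 | Suc j \<Rightarrow> coeff q j) * of_int (b (n + i))) = L (Suc n)"
      unfolding Suc L_def by (subst sum.atMost_Suc_shift) (simp add: lessThan_Suc_atMost)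
    finally show ?thesis by simp
  qed
  have L_geom: "L (n + n0) = x ^ n * L n0" for n
    by (induction n) (simp_all add: L_Suc)
  have L_eq: "L n = a * x ^ n * poly q x - (\<Sum>i<k. coeff q i * e (n + i))" for n
  proof (cases "k = 0")
    case True
    then have "q = 0" by (simp add: q_def synthetic_div_eq_0_iff k_def)
    then show ?thesis by (simp add: L_def True)
  next
    case False
    then have "degree q < k" by (simp add: q_def degree_synthetic_div k_def)
    from poly_eq_sum_lessThan[OF this, of x] show ?thesis
      by (simp add: L_def b right_diff_distrib sum_subtractf sum_distrib_left power_add mult_ac)
  qed
  \<comment> \<open>Both terms of \<open>C\<close> grow by the factor \<open>x\<close> with each
    shift, so \<open>x ^ n * C\<close> is again a sum of rounding errors and tends to 0. As
    \<open>x > 1\<close>, this forces \<open>C = 0\<close>.\<close>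
  define C where "C = L n0 - a * x ^ n0 * poly q x"
  have "C = 0"
  proof -
    have "x ^ n * C = - (\<Sum>i<k. coeff q i * e (n + n0 + i))" for n
      using L_geom[of n] L_eq[of "n + n0"] by (simp add: C_def algebra_simps power_add)
    then have "(\<lambda>n. x ^ n * C) \<longlonglongrightarrow> 0"
      using tendsto_minus[OF e_shift[of "coeff q" n0 "{..<k}"]] by simp
    moreover have "(\<lambda>n. inverse x ^ n) \<longlonglongrightarrow> 0"
      using x by (intro LIMSEQ_realpow_zero) (auto simp: field_simps)
    ultimately have "(\<lambda>n. inverse x ^ n * (x ^ n * C)) \<longlonglongrightarrow> 0 * 0"
      by (intro tendsto_mult)
    moreover have "inverse x ^ n * (x ^ n * C) = C" for n using x by (simp add: power_inverse)
    ultimately show ?thesis by (simp add: LIMSEQ_const_iff)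
  qed
  then have L0: "a * x ^ n0 * poly q x = L n0" by (simp add: C_def)
  \<comment> \<open>At \<open>x\<close> the product rule leaves only \<open>q\<close>, since the
    factor \<open>X - x\<close> vanishes there.\<close>
  have "of_int_poly (pderiv p) = pderiv ([:- x, 1:] * q)"
    unfolding pq by (rule of_int_hom.map_poly_pderiv)
  then have "poly (of_int_poly (pderiv p)) x = poly q x"
    by (simp add: pderiv_mult pderiv_pCons del: mult_pCons_left)
  moreover have "\<exists>H. \<forall>i. coeff q i = poly (of_int_poly (H i)) x"
    unfolding q_def by (rule choice) (metis coeff_synthetic_div_int_poly)
  then obtain H where H: "\<And>i. coeff q i = poly (of_int_poly (H i)) x" by blast
  have "L n0 = poly (of_int_poly (\<Sum>i<k. smult (b (n0 + i)) (H i))) x"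
    by (simp add: L_def H hom_distribs poly_sum mult.commute)
  ultimately show ?thesis using that L0 by metis
qed

subsection \<open>Denominators\<close>

lemma dvd_of_Gcd_eq_1:
  fixes N M :: "'a :: semiring_Gcd"
  assumes "Gcd A = 1" "\<And>x. x \<in> A \<Longrightarrow> N dvd M * x"
  shows "N dvd M"
proof -
  have "N dvd Gcd ((*) M ` A)" using assms(2) by (auto intro: Gcd_greatest)
  with assms(1) show ?thesis by (simp add: Gcd_mult)
qed

text \<open>The powers of \<open>\<zeta>\<close> below the degree are independent over the
  rationals, so comparing coordinates gives \<open>M * r j = N * coeff s j\<close>. Thus
  \<open>N\<close> divides \<open>M\<close> times each member of a set with gcd 1.\<close>

lemma reduced_form_dvd:
  assumes alg: "algebraic_int \<zeta>" and form: "is_reduced_form \<zeta> a r N"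
    and M: "of_int M * a = poly (of_int_poly h) \<zeta>"
  shows "N dvd M"
proof -
  let ?P = "int_min_poly \<zeta>"
  define k where "k = degree ?P"
  note P = int_min_poly_props[OF alg]
  have N: "N \<ge> 1" "Gcd (insert N (r ` {..<k})) = 1" "a = (\<Sum>j<k. of_int (r j) * \<zeta> ^ j) / of_int N"
    using form by (simp_all add: is_reduced_form_def Let_def k_def)
  have "k > 0" using degree_pos_of_root[of ?P \<zeta>] P unfolding k_def by force
  obtain q s where qs: "h = ?P * q + s" "degree s < k"
    using monic_division[OF P(1), of h] \<open>k > 0\<close> unfolding k_def by blast
  have h: "poly (of_int_poly h) \<zeta> = (poly (of_int_poly s) \<zeta> :: real)"
    using P(3) by (simp add: qs(1) hom_distribs)
  \<comment> \<open>At \<open>\<zeta>\<close> both products equal \<open>M * N * a\<close>, so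
    \<open>g\<close> vanishes there, in degree below \<open>k\<close>.\<close>
  define g where "g = smult M (\<Sum>j<k. monom (r j) j) - smult N s"
  have coeff_g: "coeff g j = M * (if j < k then r j else 0) - N * coeff s j" for j
    by (simp add: g_def coeff_sum)
  have "poly (of_int_poly g) \<zeta> = of_int M * (\<Sum>j<k. of_int (r j) * \<zeta> ^ j) - of_int N * (of_int M * a)"
    by (simp add: g_def hom_distribs poly_sum poly_monom M h)
  also have "\<dots> = 0" using N(1,3) by simp
  finally have root: "poly (of_int_poly g) \<zeta> = 0" .
  have "g = 0"
  proof (rule ccontr)
    assume "g \<noteq> 0"
    then have "k \<le> degree g" unfolding k_def by (rule prime_elem_degree_le_int[OF P(2,3) _ root])
    moreover have "coeff g j = 0" if "j \<ge> k" for j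
      using that qs(2) by (simp add: coeff_g coeff_eq_0)
    ultimately show False using leading_coeff_neq_0[OF \<open>g \<noteq> 0\<close>] by blast
  qed
  then have "M * r j = N * coeff s j" if "j < k" for j
    using coeff_g[of j] that by simp
  then have "N dvd M * r j" if "j < k" for j
    using that by (metis dvd_triv_left)
  then show ?thesis by - (rule dvd_of_Gcd_eq_1[OF N(2)], auto)
qed

text \<open>Reduce \<open>h\<close> modulo the minimal polynomial, then divide \<open>M\<close> and
  the coordinates by their common divisor.\<close>

lemma ex_reduced_form:
  assumes alg: "algebraic_int \<zeta>" and M: "M \<noteq> 0" "of_int M * a = poly (of_int_poly h) \<zeta>"
  obtains r N where "is_reduced_form \<zeta> a r N"
proof -
  let ?P = "int_min_poly \<zeta>"
  define k where "k = degree ?P"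
  note P = int_min_poly_props[OF alg]
  have "k > 0" using degree_pos_of_root[of ?P \<zeta>] P unfolding k_def by force
  obtain q s where qs: "h = ?P * q + s" "degree s < k"
    using monic_division[OF P(1), of h] \<open>k > 0\<close> unfolding k_def by blast
  have h: "poly (of_int_poly h) \<zeta> = (\<Sum>j<k. of_int (coeff s j) * \<zeta> ^ j)"
    using P(3) qs(2) by (simp add: qs(1) hom_distribs poly_eq_sum_lessThan[of _ k])
  define A where "A = insert M (coeff s ` {..<k})"
  \<comment> \<open>The sign of \<open>M\<close> goes into \<open>g\<close>, which makes the
    denominator \<open>N\<close> positive.\<close>
  define g where "g = sgn M * Gcd A"
  have "Gcd A \<noteq> 0" using M(1) by (auto simp: A_def)
  then have g: "g \<noteq> 0" "Gcd A = \<bar>g\<bar>" 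
    unfolding g_def using M(1) by (auto simp: sgn_if abs_mult simp del: Gcd_0_iff)
  have dvd: "g dvd y" if "y \<in> A" for y
    using Gcd_dvd[OF that] g(2) by simp
  define N where "N = M div g"
  define r where "r = (\<lambda>j. coeff s j div g)"
  have gN: "M = g * N" using dvd[of M] by (simp add: N_def A_def)
  have gr: "coeff s j = g * r j" if "j < k" for j using dvd[of "coeff s j"] that by (simp add: r_def A_def)
  have "\<bar>M\<bar> = sgn M * M" by (simp add: abs_sgn mult.commute)
  also have "\<dots> = sgn M * (g * N)" by (rule arg_cong[OF gN])
  also have "\<dots> = Gcd A * N" using M(1) by (simp add: g_def sgn_if)
  finally have "\<bar>M\<bar> = Gcd A * N" .
  then have "N \<ge> 1" using M(1) \<open>Gcd A \<noteq> 0\<close>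
    by (metis Gcd_int_greater_eq_0 int_one_le_iff_zero_less zero_less_abs_iff zero_less_mult_pos order_le_less)
  moreover have "A = (*) g ` insert N (r ` {..<k})"
    using gN gr by (auto simp: A_def image_image)
  then have "\<bar>g\<bar> = \<bar>g\<bar> * Gcd (insert N (r ` {..<k}))"
    using g(2) by (metis Gcd_mult Gcd_int_greater_eq_0 abs_mult abs_of_nonneg normalize_int_def)
  then have "Gcd (insert N (r ` {..<k})) = 1" using g(1) by simp
  moreover have "of_int M * a = of_int g * (\<Sum>j<k. of_int (r j) * \<zeta> ^ j)"
    unfolding M(2) h using gr by (simp add: sum_distrib_left mult.assoc)
  then have "of_int N * a = (\<Sum>j<k. of_int (r j) * \<zeta> ^ j)"
    using g(1) by (simp add: gN)
  then have "a = (\<Sum>j<k. of_int (r j) * \<zeta> ^ j) / of_int N"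
    using \<open>N \<ge> 1\<close> by (simp add: field_simps)
  ultimately show ?thesis
    by (intro that[of r N]) (simp add: is_reduced_form_def k_def)
qed

text \<open>The denominators of two reduced forms of \<open>a\<close> are positive and divide each
  other, so the definite description in \<open>reduced_denominator\<close> is resolved.\<close>

lemma reduced_denominator_dvd:
  assumes alg: "algebraic_int \<zeta>" and M: "M \<noteq> 0" "of_int M * a = poly (of_int_poly h) \<zeta>"
  shows "reduced_denominator \<zeta> a dvd M"
proof -
  obtain r N where rN: "is_reduced_form \<zeta> a r N" using ex_reduced_form[OF assms] .
  have dvd: "N1 dvd N2" if "is_reduced_form \<zeta> a r1 N1" "is_reduced_form \<zeta> a r2 N2" for r1 N1 r2 N2
  proof (rule reduced_form_dvd[OF alg that(1)])
    show "of_int N2 * a = poly (of_int_poly (\<Sum>j<degree (int_min_poly \<zeta>). monom (r2 j) j)) \<zeta>"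
    proof -
      from that(2) have "N2 \<ge> 1" "a = (\<Sum>j<degree (int_min_poly \<zeta>). of_int (r2 j) * \<zeta> ^ j) / of_int N2"
        by (simp_all add: is_reduced_form_def Let_def)
      then have "of_int N2 * a = (\<Sum>j<degree (int_min_poly \<zeta>). of_int (r2 j) * \<zeta> ^ j)" by simp
      then show ?thesis by (simp add: hom_distribs poly_sum poly_monom)
    qed
  qed
  have "reduced_denominator \<zeta> a = N"
    unfolding reduced_denominator_def
  proof (rule the_equality)
    fix N' assume "\<exists>r. is_reduced_form \<zeta> a r N'"
    then obtain r' where r': "is_reduced_form \<zeta> a r' N'" by blast
    then have "N' \<ge> 1" "N \<ge> 1" using rN by (simp_all add: is_reduced_form_def Let_def)
    then show "N' = N" using dvd[OF r' rN] dvd[OF rN r'] by (simp add: zdvd_antisym_nonneg)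
  qed (use rN in blast)
  with reduced_form_dvd[OF alg rN M(2)] show ?thesis by simp
qed

text \<open>A monic polynomial vanishing at the inverse has a reflection that vanishes at
  \<open>\<zeta>\<close> and has constant coefficient 1. The minimal polynomial divides this
  reflection, so its own constant coefficient divides 1.\<close>

lemma algebraic_unit_imp_unit_const_coeff:
  assumes "algebraic_unit \<zeta>"
  shows "is_unit (poly (int_min_poly \<zeta>) 0)"
proof -
  let ?P = "int_min_poly \<zeta>"
  from assms have \<zeta>: "\<zeta> \<noteq> 0" "algebraic_int \<zeta>" "algebraic_int (inverse \<zeta>)"
    by (simp_all add: algebraic_unit_def)
  note P = int_min_poly_props[OF \<zeta>(2)]
  obtain f :: "int poly" where f: "poly (of_int_poly f) (inverse \<zeta>) = 0" "lead_coeff f = 1"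
    using \<zeta>(3) by (auto simp: algebraic_int_altdef_ipoly)
  have "of_int_poly (reflect_poly f) = (reflect_poly (of_int_poly f) :: real poly)"
    by (intro poly_eqI) (simp add: coeff_reflect_poly)
  then have h: "poly (of_int_poly (reflect_poly f)) \<zeta> = 0"
    using f(1) \<zeta>(1) by (simp add: poly_reflect_poly_nz)
  have pos: "degree ?P > 0" using degree_pos_of_root[of ?P \<zeta>] P by force
  obtain q s where qs: "reflect_poly f = ?P * q + s" "degree s < degree ?P"
    using monic_division[OF P(1) pos] by blast
  have "poly (of_int_poly s) \<zeta> = 0" using h P(3) by (simp add: qs(1) hom_distribs)
  then have "s = 0" using prime_elem_degree_le_int[OF P(2,3), of s] qs(2) by fastforce
  then have "poly (reflect_poly f) 0 = poly ?P 0 * poly q 0" by (simp add: qs(1))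
  moreover have "poly (reflect_poly f) 0 = 1" using f(2) by (simp add: poly_0_coeff_0)
  ultimately show ?thesis by (metis dvd_triv_left)
qed

section \<open>Bounding the denominators of elements of the Pisot set\<close>

lemma reduced_denominator_dvd_discriminant:
  assumes alg: "algebraic_int \<zeta>" and gt: "\<zeta> > 1" and a: "a \<in> pisot_set \<zeta>"
    and P0: "poly (int_min_poly \<zeta>) 0 \<noteq> 0"
  obtains n where
    "reduced_denominator \<zeta> a dvd poly_discriminant (int_min_poly \<zeta>) * poly (int_min_poly \<zeta>) 0 ^ n"
proof -
  let ?P = "int_min_poly \<zeta>"
  note P = int_min_poly_props[OF alg]
  have pos: "degree ?P > 0" using degree_pos_of_root[of ?P \<zeta>] P by force
  obtain V Q where VQ: "V * pderiv ?P = [:poly_discriminant ?P:] + ?P * Q" "poly_discriminant ?P \<noteq> 0"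
    using poly_discriminant_in_ideal[OF P(1,2) pos] .
  \<comment> \<open>Evaluated at \<open>\<zeta>\<close>, the ideal identity loses its multiple of
    \<open>?P\<close>.\<close>
  have "poly (of_int_poly V) \<zeta> * poly (of_int_poly (pderiv ?P)) \<zeta> =
      poly (of_int_poly (V * pderiv ?P)) \<zeta>"
    by (simp only: hom_distribs poly_mult)
  also have "\<dots> = of_int (poly_discriminant ?P)"
    unfolding VQ(1) using P(3) by (simp add: hom_distribs)
  finally have disc: "poly (of_int_poly V) \<zeta> * poly (of_int_poly (pderiv ?P)) \<zeta> =
      of_int (poly_discriminant ?P)" .
  obtain n h where nh: "a * \<zeta> ^ n * poly (of_int_poly (pderiv ?P)) \<zeta> = poly (of_int_poly h) \<zeta>"
    using nearest_int_tendsto_zero_imp[OF P(3) gt] a unfolding pisot_set_def by blast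
  \<comment> \<open>Evaluating \<open>?P = c + X * U\<close> at \<open>\<zeta>\<close> shows that
    \<open>\<zeta>\<close> divides the constant coefficient in Z[\<zeta>].\<close>
  obtain c U where U: "?P = pCons c U" by (cases "?P")
  then have "of_int c + \<zeta> * poly (of_int_poly U) \<zeta> = 0"
    using P(3) by (simp add: hom_distribs)
  then have c: "of_int (poly ?P 0) = \<zeta> * poly (of_int_poly (- U)) \<zeta>"
    by (simp add: U hom_distribs)
  let ?M = "poly_discriminant ?P * poly ?P 0 ^ n"
  \<comment> \<open>Each factor \<open>poly ?P 0\<close> supplies one \<open>\<zeta>\<close>, and
    the discriminant supplies the value of the derivative.\<close>
  have "of_int ?M * a = poly (of_int_poly V) \<zeta> * poly (of_int_poly (- U)) \<zeta> ^ n *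
      (a * \<zeta> ^ n * poly (of_int_poly (pderiv ?P)) \<zeta>)"
    by (simp add: c power_mult_distrib flip: disc)
  also have "\<dots> = poly (of_int_poly (V * (- U) ^ n * h)) \<zeta>"
    unfolding nh by (simp only: hom_distribs poly_mult poly_power)
  finally have "reduced_denominator \<zeta> a dvd ?M"
    using VQ(2) P0 by (intro reduced_denominator_dvd[OF alg]) simp_all
  then show ?thesis by (rule that)
qed

theorem theorem3p17:
  fixes \<zeta> :: real
  assumes "pisot_number \<zeta>"
  shows "(\<forall>q :: int. prime q \<and> \<not> q dvd poly (pisot_poly \<zeta>) 0 \<longrightarrow>
            (\<forall>a \<in> pisot_set \<zeta>. multiplicity q (reduced_denominator \<zeta> a)
                                \<le> multiplicity q (poly_discriminant (pisot_poly \<zeta>)))) \<and>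
         (algebraic_unit \<zeta> \<longrightarrow>
            (\<forall>a \<in> pisot_set \<zeta>. reduced_denominator \<zeta> a dvd poly_discriminant (pisot_poly \<zeta>)))"
proof (intro conjI allI ballI impI)
  let ?P = "pisot_poly \<zeta>"
  have \<zeta>: "algebraic_int \<zeta>" "\<zeta> > 1" using assms by (simp_all add: pisot_number_def)
  note P = int_min_poly_props[OF \<zeta>(1)]
  have "degree ?P > 0" using degree_pos_of_root[of ?P \<zeta>] P by force
  from poly_discriminant_in_ideal[OF P(1,2) this] have disc: "poly_discriminant ?P \<noteq> 0" by blast
  {
    fix q :: int and a
    assume q: "prime q \<and> \<not> q dvd poly ?P 0" and a: "a \<in> pisot_set \<zeta>"
    \<comment> \<open>Every integer divides 0, so the constant coefficient cannot vanish.\<close>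
    then have P0: "poly ?P 0 \<noteq> 0" by auto
    obtain n where "reduced_denominator \<zeta> a dvd poly_discriminant ?P * poly ?P 0 ^ n"
      using reduced_denominator_dvd_discriminant[OF \<zeta> a P0] .
    then have "multiplicity q (reduced_denominator \<zeta> a)
        \<le> multiplicity q (poly_discriminant ?P * poly ?P 0 ^ n)"
      using disc P0 by (intro dvd_imp_multiplicity_le) auto
    also have "\<dots> = multiplicity q (poly_discriminant ?P) + multiplicity q (poly ?P 0 ^ n)"
      using q disc P0 by (intro prime_elem_multiplicity_mult_distrib) auto
    \<comment> \<open>A prime not dividing the constant coefficient divides no power of it, so the
      extra factor adds no multiplicity.\<close>
    also have "multiplicity q (poly ?P 0 ^ n) = 0"
      using q by (intro not_dvd_imp_multiplicity_0) (auto dest: prime_dvd_power)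
    finally show "multiplicity q (reduced_denominator \<zeta> a) \<le> multiplicity q (poly_discriminant ?P)"
      by simp
  next
    fix a assume "algebraic_unit \<zeta>" and a: "a \<in> pisot_set \<zeta>"
    then have unit: "is_unit (poly ?P 0)" by (intro algebraic_unit_imp_unit_const_coeff)
    then have "poly ?P 0 \<noteq> 0" by auto
    from reduced_denominator_dvd_discriminant[OF \<zeta> a this] obtain n where
      "reduced_denominator \<zeta> a dvd poly_discriminant ?P * poly ?P 0 ^ n" .
    moreover have "is_unit (poly ?P 0 ^ n)" using unit by (simp add: power_abs)
    ultimately show "reduced_denominator \<zeta> a dvd poly_discriminant ?P"
      by (simp add: dvd_mult_unit_iff)
  }
qed

end
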